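(* Let $p$ be an odd prime and let $k\ge 3$ be an integer. If $G$ is a group of order $p^{2k-1}$ then not all groups of order $p^k$ can be embedded in $G$.
   Context: A group $K$ can be embedded in a group $G$ if $G$ has a subgroup isomorphic to $K$; "all groups of order $m$ can be embedded in $G$" means that every group of order $m$ is isomorphic to some subgroup of $G$. *)

theory Defs
  imports "HOL-Algebra.Algebra" "HOL-Computational_Algebra.Primes"
begin

definition embeds_in :: "('a, 'm) monoid_scheme \<Rightarrow> ('b, 'n) monoid_scheme \<Rightarrow> bool" where
  "embeds_in K G \<longleftrightarrow> (\<exists>H. subgroup H G \<and> K \<cong> G\<lparr>carrier := H\<rparr>)"

text \<open>
  A quantifier inside a formula cannot range over all types. For finite orders nothing is lost by
  taking the groups of order \<open>n\<close> to have elements in \<^typ>\<open>nat\<close>: every finite group is isomorphic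
  to such a group, so an embedding property of all of them transfers to groups over any type
  (\<open>all_groups_embed_any_type\<close>). The hypothesis \<open>n > 0\<close> there is needed because \<open>order\<close> is \<open>0\<close>
  for infinite groups.
\<close>

definition all_groups_embed :: "nat \<Rightarrow> ('a, 'm) monoid_scheme \<Rightarrow> bool" where
  "all_groups_embed n G \<longleftrightarrow> (\<forall>K :: nat monoid. group K \<and> Coset.order K = n \<longrightarrow> embeds_in K G)"

lemma finite_group_iso_nat:
  assumes "group K" and "finite (carrier K)"
  obtains L :: "nat monoid" where "group L" and "K \<cong> L"
proof -
  interpret K: group K by fact
  obtain f :: "_ \<Rightarrow> nat" where f: "inj_on f (carrier K)"
    using finite_imp_inj_to_nat_seg[OF assms(2)] by blast
  define g where "g = the_inv_into (carrier K) f"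
  have g: "g (f x) = x" if "x \<in> carrier K" for x
    using the_inv_into_f_f[OF f that] by (simp add: g_def)
  define L :: "nat monoid" where
    "L = \<lparr>carrier = f ` carrier K, monoid.mult = (\<lambda>x y. f (g x \<otimes>\<^bsub>K\<^esub> g y)), one = f \<one>\<^bsub>K\<^esub>\<rparr>"
  have "group L"
  proof (rule groupI)
    fix x assume "x \<in> carrier L"
    then obtain a where a: "a \<in> carrier K" "x = f a" by (auto simp: L_def)
    show "\<exists>y\<in>carrier L. y \<otimes>\<^bsub>L\<^esub> x = \<one>\<^bsub>L\<^esub>"
      using a by (intro bexI[of _ "f (inv\<^bsub>K\<^esub> a)"]) (auto simp: L_def g)
  qed (auto simp: L_def g K.m_assoc)
  moreover have "f \<in> iso K L"
    using f by (auto simp: iso_def hom_def bij_betw_def L_def g)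
  ultimately show thesis
    using that by (auto simp: is_iso_def)
qed

lemma all_groups_embed_any_type:
  fixes K :: "('b, 'n) monoid_scheme"
  assumes "all_groups_embed n G" and "n > 0" and "group K" and "Coset.order K = n"
  shows "embeds_in K G"
proof -
  have "finite (carrier K)"
    using assms by (auto simp: Coset.order_def intro: card_ge_0_finite)
  then obtain L :: "nat monoid" where L: "group L" "K \<cong> L"
    using finite_group_iso_nat[OF assms(3)] by blast
  then have "embeds_in L G"
    using assms iso_same_card[OF L(2)] by (simp add: all_groups_embed_def Coset.order_def)
  then show ?thesis
    using L(2) iso_trans by (auto simp: embeds_in_def)
qed

end

theory Submission
  imports Defs
begin

text \<open>
  Suppose that every group of order \<open>p ^ k\<close> embeds in \<open>G\<close>. Then \<open>G\<close> contains an elementary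
  abelian subgroup \<open>E\<close> of order \<open>p ^ k\<close>, an element \<open>c\<close> of order \<open>p ^ k\<close>, and, since \<open>p\<close> is odd
  and \<open>k \<ge> 3\<close>, a nonabelian subgroup of order \<open>p ^ k\<close> and exponent \<open>p\<close>, namely the Heisenberg
  group modulo \<open>p\<close> times an elementary abelian group. The contradiction is that, in the presence of
  \<open>E\<close> and \<open>c\<close>, any two elements \<open>x\<close> with \<open>x ^ p = 1\<close> commute (\<open>elements_of_order_p_commute\<close>).

  A subgroup \<open>S\<close> of exponent \<open>p\<close> meets the cyclic group \<open>C\<close> generated by \<open>c\<close> in at most \<open>p\<close>
  elements, so \<open>S C\<close> has at least \<open>card S * p ^ (k - 1)\<close> elements. As \<open>G\<close> has only
  \<open>p ^ (2 * k - 1)\<close>, this gives \<open>card S \<le> p ^ k\<close>, and it gives \<open>G = E C\<close>. In particular no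
  subgroup of exponent \<open>p\<close> properly contains \<open>E\<close>.

  This maximality makes \<open>E\<close> normal (\<open>maximal_elementary_abelian_subgroup_normal\<close>). Otherwise the
  normalizer of \<open>E\<close> is a proper subgroup of a \<open>p\<close>-group, hence is normalized by some \<open>g\<close> outside it,
  and \<open>E\<close> and its conjugate \<open>F\<close> by \<open>g\<close> are distinct and normalize each other. Commutators of \<open>E\<close>
  with \<open>F\<close> then lie in the intersection of \<open>E\<close> and \<open>F\<close>, which is central in \<open>E F\<close>; so \<open>E F\<close> has
  class at most two and, \<open>p\<close> being odd, exponent \<open>p\<close>, although it properly contains \<open>E\<close>.

  Now \<open>c\<close> acts on the \<open>k\<close>-dimensional space \<open>E\<close> over the field with \<open>p\<close> elements by a unipotent
  map \<open>T = 1 + D\<close>. Here \<open>D ^ k = 0\<close> and \<open>T ^ (p ^ m) = 1 + D ^ (p ^ m)\<close>, so from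
  \<open>k \<le> p ^ (k - 2)\<close> it follows that \<open>d = c ^ (p ^ (k - 2))\<close> centralizes \<open>E\<close>
  (\<open>p_power_order_endomorphism\<close>).

  Finally let \<open>x ^ p = 1\<close> and write \<open>x = e c ^ i\<close> with \<open>e\<close> in \<open>E\<close>. Reduction modulo \<open>E\<close> shows that
  \<open>c ^ (i p)\<close> lies in \<open>E\<close>, so \<open>c ^ (i p p) = 1\<close> and \<open>c ^ i\<close> is a power of \<open>d\<close>. Hence all such
  \<open>x\<close> lie in the subgroup generated by \<open>E\<close> and \<open>d\<close>, which is abelian.
\<close>

section \<open>Unipotent endomorphisms of elementary abelian groups\<close>

lemma (in group) funpow_hom:
  assumes "T \<in> hom G G"
  shows "(T ^^ n) \<in> hom G G"
proof (induction n)
  case 0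
  then show ?case by (simp add: hom_def)
next
  case (Suc n)
  then show ?case
    using assms by (auto simp: hom_def Pi_def)
qed

text \<open>
  The endomorphisms of an abelian group form a ring, in which \<open>T = 1 + D\<close>; this is the binomial
  theorem for \<open>(1 + D) ^ n\<close> in multiplicative notation. Peeling off the innermost \<open>T\<close> as
  \<open>T x = x \<otimes> D x\<close> makes the induction step an instance of Pascal's rule.
\<close>

lemma (in comm_group) binomial_endomorphism:
  assumes T: "T \<in> hom G G" and D: "D \<in> hom G G"
    and TD: "\<And>x. x \<in> carrier G \<Longrightarrow> T x = x \<otimes> D x"
    and x: "x \<in> carrier G"
  shows "(T ^^ n) x = (\<Otimes>j\<in>{..n}. (D ^^ j) x [^] (n choose j))"
  using x
proof (induction n arbitrary: x)
  case 0
  then show ?case by simp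
next
  case (Suc n)
  have Dc: "(D ^^ j) y \<in> carrier G" if "y \<in> carrier G" for j y
    using funpow_hom[OF D] that by (auto simp: hom_def Pi_def)
  have Dx: "D x \<in> carrier G"
    using Dc[OF Suc.prems, of 1] by simp
  let ?P = "\<lambda>j. (D ^^ j) x [^] (n choose j)" and ?Q = "\<lambda>j. (D ^^ Suc j) x [^] (n choose j)"
  let ?R = "\<lambda>j. (D ^^ j) x [^] (Suc n choose j)" and ?P' = "\<lambda>j. (D ^^ Suc j) x [^] (n choose Suc j)"
  have "(T ^^ Suc n) x = (T ^^ n) (x \<otimes> D x)"
    using TD[OF Suc.prems] by (simp add: funpow_swap1)
  also have "\<dots> = (T ^^ n) x \<otimes> (T ^^ n) (D x)"
    using funpow_hom[OF T, of n] Suc.prems Dx by (auto simp: hom_def)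
  also have "\<dots> = finprod G ?P {..n} \<otimes> finprod G ?Q {..n}"
    by (simp add: Suc.IH[OF Suc.prems] Suc.IH[OF Dx] funpow_swap1)
  also have "finprod G ?P {..n} = finprod G ?P {..Suc n}"
    using Suc.prems Dc finprod_closed[of ?P "{..n}"] by (simp add: Pi_def binomial_eq_0 del: funpow.simps)
  also have "\<dots> = finprod G ?P' {..n} \<otimes> x"
    using Suc.prems Dc by (subst finprod_Suc2) (auto simp: Pi_def simp del: funpow.simps(2))
  also have "finprod G ?P' {..n} \<otimes> x \<otimes> finprod G ?Q {..n}
      = finprod G ?P' {..n} \<otimes> finprod G ?Q {..n} \<otimes> x"
    using Suc.prems Dc finprod_closed[of ?P' "{..n}"] finprod_closed[of ?Q "{..n}"]
    by (simp add: Pi_def m_ac del: funpow.simps)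
  also have "finprod G ?P' {..n} \<otimes> finprod G ?Q {..n} = finprod G (\<lambda>j. ?P' j \<otimes> ?Q j) {..n}"
    using Suc.prems Dc by (subst finprod_multf) (auto simp del: funpow.simps)
  also have "(\<lambda>j. ?P' j \<otimes> ?Q j) = (\<lambda>j. ?R (Suc j))"
    using Suc.prems Dc by (simp add: nat_pow_mult add.commute del: funpow.simps)
  also have "finprod G (\<lambda>j. ?R (Suc j)) {..n} \<otimes> x = finprod G ?R {..Suc n}"
    using Suc.prems Dc by (subst finprod_Suc2) (auto simp: Pi_def simp del: funpow.simps(2))
  finally show ?case .
qed

text \<open>
  In exponent \<open>p\<close> all binomial coefficients other than the two extreme ones act as zero, so
  \<open>(1 + D) ^ p = 1 + D ^ p\<close>.
\<close>

lemma (in comm_group) frobenius_endomorphism: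
  assumes p: "Factorial_Ring.prime (p :: nat)"
    and exp: "\<And>x. x \<in> carrier G \<Longrightarrow> x [^] p = \<one>"
    and "T \<in> hom G G" and "D \<in> hom G G"
    and "\<And>x. x \<in> carrier G \<Longrightarrow> T x = x \<otimes> D x"
    and x: "x \<in> carrier G"
  shows "(T ^^ p) x = x \<otimes> (D ^^ p) x"
proof -
  have Dc: "(D ^^ j) x \<in> carrier G" for j
    using funpow_hom[OF assms(4)] x by (auto simp: hom_def Pi_def)
  obtain q where q: "p = Suc q"
    using p by (metis not0_implies_Suc not_prime_0)
  let ?f = "\<lambda>j. (D ^^ j) x [^] (p choose j)"
  have f: "?f \<in> A \<rightarrow> carrier G" for A
    using Dc by auto
  have "?f j = \<one>" if "j \<in> {Suc 0..q}" for j
  proof -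
    have "p dvd p choose j"
      using that q by (intro dvd_choose_prime) (use p in auto)
    then obtain r where "p choose j = p * r" ..
    then show ?thesis
      using Dc exp by (simp flip: nat_pow_pow)
  qed
  then have "finprod G ?f {Suc 0..q} = \<one>"
    by (intro finprod_one_eqI)
  then have "finprod G ?f {..q} = x"
    using finprod_0'[OF f, of q] x by simp
  then have "finprod G ?f {..p} = (D ^^ p) x \<otimes> x"
    using finprod_Suc[OF f, of q] Dc q by (simp del: funpow.simps)
  then show ?thesis
    using binomial_endomorphism[OF assms(3-5) x, of p] Dc x by (simp add: m_comm)
qed

lemma (in comm_group) iterated_frobenius_endomorphism:
  assumes p: "Factorial_Ring.prime (p :: nat)"
    and exp: "\<And>x. x \<in> carrier G \<Longrightarrow> x [^] p = \<one>"
    and "T \<in> hom G G" and "D \<in> hom G G"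
    and "\<And>x. x \<in> carrier G \<Longrightarrow> T x = x \<otimes> D x"
    and x: "x \<in> carrier G"
  shows "(T ^^ (p ^ m)) x = x \<otimes> (D ^^ (p ^ m)) x"
  using assms(3-5)
proof (induction m arbitrary: T D)
  case 0
  then show ?case using x by simp
next
  case (Suc m)
  have "((T ^^ p) ^^ (p ^ m)) x = x \<otimes> ((D ^^ p) ^^ (p ^ m)) x"
    using Suc.prems frobenius_endomorphism[OF p exp Suc.prems]
    by (intro Suc.IH funpow_hom)
  then show ?case
    by (simp add: funpow_mult mult.commute)
qed

text \<open>
  The images of the powers of \<open>D\<close> form a descending chain of subgroups that is strict until it
  reaches the trivial group, because it would otherwise be constant from some point on and
  nilpotency would fail. Each strict step divides the order by at least \<open>p\<close>, so \<open>k\<close> steps suffice.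
\<close>

lemma (in group) nilpotent_endomorphism_index:
  assumes p: "Factorial_Ring.prime (p :: nat)" and card: "Coset.order G = p ^ k"
    and D: "D \<in> hom G G"
    and nil: "\<And>x. x \<in> carrier G \<Longrightarrow> (D ^^ M) x = \<one>"
    and x: "x \<in> carrier G"
  shows "(D ^^ k) x = \<one>"
proof -
  define I where "I i = (D ^^ i) ` carrier G" for i
  have sub: "subgroup (I i) G" for i
    unfolding I_def using funpow_hom[OF D]
    by (intro group_hom.img_is_subgroup) (auto simp: group_hom_def group_hom_axioms_def)
  have fin: "finite (carrier G)"
    using card p prime_gt_0_nat by (metis card_gt_0_iff order_def zero_less_power)
  have Iadd: "I (i + j) = (D ^^ j) ` I i" for i j
    unfolding I_def by (simp add: image_image funpow_add add.commute[of i j])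
  have step: "card (I (Suc i)) < card (I i)" if "I i \<noteq> {\<one>}" for i
  proof -
    have finI: "finite (I i)"
      using sub[of i] fin subgroup.subset finite_subset by metis
    have "I (Suc i) \<subseteq> I i"
      unfolding I_def using D by (auto simp: funpow_swap1 hom_def Pi_def)
    moreover have "I (Suc i) \<noteq> I i"
    proof
      assume eq: "I (Suc i) = I i"
      have "I (i + j) = I i" for j
      proof (induction j)
        case (Suc j)
        then show ?case
          using Iadd[of "i + j" 1] Iadd[of i 1] eq by simp
      qed simp
      then have "I i = I (M + i)"
        by (metis add.commute)
      also have "\<dots> \<subseteq> {\<one>}"
        using Iadd[of M i] nil funpow_hom[OF D, of i] hom_one[of "D ^^ i" G G] is_group
        by (auto simp: I_def)
      finally show False
        using that subgroup.one_closed[OF sub[of i]] by auto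
    qed
    ultimately show ?thesis
      using finI psubset_card_mono by blast
  qed
  have "card (I i) dvd p ^ (k - i)" for i
  proof (induction i)
    case 0
    then show ?case
      using card by (simp add: I_def order_def)
  next
    case (Suc i)
    show ?case
    proof (cases "I i = {\<one>}")
      case True
      then have "I (Suc i) = {\<one>}"
        using Iadd[of i 1] hom_one[OF D] is_group by simp
      then show ?thesis by simp
    next
      case False
      obtain a where a: "card (I i) = p ^ a" "a \<le> k - i"
        using Suc.IH p by (metis divides_primepow_nat)
      have "card (I (Suc i)) dvd p ^ k"
        using lagrange_finite[OF fin sub[of "Suc i"]] card by (metis dvd_triv_right)
      then obtain b where b: "card (I (Suc i)) = p ^ b"
        using p by (metis divides_primepow_nat)
      have "b < a"
        using step[OF False] a b prime_gt_1_nat[OF p] by simp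
      then show ?thesis
        using a b by (simp add: le_imp_power_dvd)
    qed
  qed
  from this[of k] have "card (I k) = 1" by simp
  then have "I k = {\<one>}"
    using subgroup.one_closed[OF sub[of k]] by (metis card_1_singletonE singletonD)
  then show ?thesis
    using x by (auto simp: I_def)
qed

text \<open>
  A unipotent map of a \<open>k\<close>-dimensional space in characteristic \<open>p\<close> has order at most the least power
  of \<open>p\<close> that is at least \<open>k\<close>. Having \<open>p\<close>-power order makes \<open>D = T - 1\<close> nilpotent, since
  \<open>0 = T ^ (p ^ n) - 1 = D ^ (p ^ n)\<close>; then \<open>D ^ k = 0\<close>, hence \<open>T ^ (p ^ m) = 1 + D ^ (p ^ m) = 1\<close>.
\<close>

lemma (in comm_group) p_power_order_endomorphism:
  assumes p: "Factorial_Ring.prime (p :: nat)" and card: "Coset.order G = p ^ k"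
    and exp: "\<And>x. x \<in> carrier G \<Longrightarrow> x [^] p = \<one>"
    and T: "T \<in> hom G G"
    and ord: "\<And>x. x \<in> carrier G \<Longrightarrow> (T ^^ (p ^ n)) x = x"
    and km: "k \<le> p ^ m"
    and x: "x \<in> carrier G"
  shows "(T ^^ (p ^ m)) x = x"
proof -
  define D where "D = (\<lambda>x. T x \<otimes> inv x)"
  have Tc: "T y \<in> carrier G" if "y \<in> carrier G" for y
    using T that by (auto simp: hom_def Pi_def)
  have D: "D \<in> hom G G"
    using T Tc by (auto simp: hom_def D_def inv_mult m_ac)
  have TD: "T y = y \<otimes> D y" if "y \<in> carrier G" for y
    using Tc[OF that] that by (simp add: D_def m_comm[of "T y"] flip: m_assoc)
  have Dc: "(D ^^ j) y \<in> carrier G" if "y \<in> carrier G" for j y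
    using funpow_hom[OF D] that by (auto simp: hom_def Pi_def)
  note frob = iterated_frobenius_endomorphism[OF p exp T D TD]
  have "(D ^^ (p ^ n)) y = \<one>" if y: "y \<in> carrier G" for y
    using frob[OF _ _ y, of n] ord[OF y] Dc[OF y] y by (metis l_cancel_one')
  then have "(D ^^ k) y = \<one>" if "y \<in> carrier G" for y
    using nilpotent_endomorphism_index[OF p card D] that by blast
  then have "(D ^^ (p ^ m - k + k)) x = \<one>"
    using x hom_one[OF funpow_hom[OF D]] is_group by (simp only: funpow_add o_apply)
  then show ?thesis
    using frob[OF _ _ x, of m] km x by simp
qed

section \<open>Normalizers in finite p-groups\<close>

text \<open>
  Orbits of a group of order \<open>p ^ n\<close> have \<open>p\<close>-power size, so an orbit that is not a single fixed
  point has size divisible by \<open>p\<close>. Allowing an invariant subset \<open>S\<close> of the space acted upon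
  spares restricting the action to \<open>S\<close>.
\<close>

lemma (in group_action) prime_dvd_card_nonfixed_points:
  assumes p: "Factorial_Ring.prime (p :: nat)" and order: "Coset.order G = p ^ n"
    and S: "S \<subseteq> E" "finite S"
    and inv: "\<And>g x. g \<in> carrier G \<Longrightarrow> x \<in> S \<Longrightarrow> \<phi> g x \<in> S"
  shows "p dvd card {x \<in> S. \<exists>g\<in>carrier G. \<phi> g x \<noteq> x}"
proof -
  define Y where "Y = {x \<in> S. \<exists>g\<in>carrier G. \<phi> g x \<noteq> x}"
  define C where "C = orbit G \<phi> ` Y"
  interpret G: group G
    using group_hom group_hom.axioms(1) by blast
  have YE: "x \<in> E" if "x \<in> Y" for x
    using that S by (auto simp: Y_def)
  have fixed_orbit: "y = x" if "x \<in> E" "\<And>g. g \<in> carrier G \<Longrightarrow> \<phi> g x = x" "x \<in> orbit G \<phi> y" "y \<in> E" for x y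
    using orbit_sym[OF that(4,1)] that by (auto simp: orbit_def)
  have orbit_Y: "orbit G \<phi> x \<subseteq> Y" if "x \<in> Y" for x
  proof
    fix y assume y: "y \<in> orbit G \<phi> x"
    then have "y \<in> S"
      using that inv by (auto simp: orbit_def Y_def)
    moreover have "\<exists>g\<in>carrier G. \<phi> g y \<noteq> y"
      using fixed_orbit[of y x] y that S \<open>y \<in> S\<close> by (auto simp: Y_def)
    ultimately show "y \<in> Y" by (simp add: Y_def)
  qed
  have UC: "\<Union> C = Y"
    using orbit_Y orbit_refl YE by (auto simp: C_def)
  have "p dvd card (\<Union> C)"
  proof (rule dvd_partition)
    show "finite (\<Union> C)"
      using UC S by (simp add: Y_def)
    show "\<forall>c\<in>C. p dvd card c"
    proof
      fix c assume "c \<in> C"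
      then obtain x where x: "x \<in> Y" "c = orbit G \<phi> x"
        by (auto simp: C_def)
      have "card c dvd p ^ n"
        using orbit_stabilizer_theorem[OF YE[OF x(1)]] x(2) order by (metis dvd_triv_left)
      then obtain a where a: "card c = p ^ a"
        using p by (metis divides_primepow_nat)
      have "a \<noteq> 0"
      proof
        assume "a = 0"
        then obtain y where "c = {y}"
          using a by (metis card_1_singletonE power_0)
        then have "\<phi> g x = x" if "g \<in> carrier G" for g
          using x that orbit_refl[OF YE[OF x(1)]] by (auto simp: orbit_def)
        then show False
          using x by (auto simp: Y_def)
      qed
      then show "p dvd card c"
        using a by simp
    qed
    show "\<forall>c1\<in>C. \<forall>c2\<in>C. c1 \<noteq> c2 \<longrightarrow> c1 \<inter> c2 = {}"
      using disjoint_union YE by (auto simp: C_def orbits_def)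
  qed
  then show ?thesis
    by (simp add: UC Y_def)
qed

lemma (in group) mult_inv_cancel:
  assumes "x \<in> carrier G" "y \<in> carrier G"
  shows "inv x \<otimes> (x \<otimes> y) = y" and "x \<otimes> (inv x \<otimes> y) = y"
  using assms by (simp_all flip: m_assoc)

text \<open>
  Proper subgroups of finite \<open>p\<close>-groups are strictly smaller than their normalizers. Let \<open>N\<close> act by
  conjugation on its own conjugates. A fixed conjugate \<open>F\<close> has \<open>N\<close> in its normalizer, which is \<open>F\<close>
  because conjugates of \<open>N\<close> are self-normalizing too; so \<open>N\<close> is the only fixed point. The number of
  conjugates is therefore \<open>1\<close> modulo \<open>p\<close>, but it is also a power of \<open>p\<close>, hence it is \<open>1\<close>. Thus \<open>N\<close>
  is normal, and its normalizer is both \<open>N\<close> and the whole group.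
\<close>

lemma (in group) self_normalizing_subgroup_eq_carrier:
  assumes p: "Factorial_Ring.prime (p :: nat)" and order: "Coset.order G = p ^ n"
    and N: "subgroup N G"
    and self: "\<And>g. g \<in> carrier G \<Longrightarrow> (\<And>x. x \<in> N \<Longrightarrow> g \<otimes> x \<otimes> inv g \<in> N \<and> inv g \<otimes> x \<otimes> g \<in> N) \<Longrightarrow> g \<in> N"
  shows "N = carrier G"
proof -
  define \<phi> where "\<phi> = (\<lambda>g. \<lambda>H \<in> {H. H \<subseteq> carrier G}. g <# H #> (inv g))"
  interpret act: group_action G "{H. H \<subseteq> carrier G}" \<phi>
    unfolding \<phi>_def by (rule action_by_conjugation_on_power_set)
  have NG: "N \<subseteq> carrier G"
    using N subgroup.subset by blast
  have fin: "finite (carrier G)"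
    using order p prime_gt_0_nat by (metis card_gt_0_iff order_def zero_less_power)
  have \<phi>N: "\<phi> g N = (\<lambda>x. g \<otimes> x \<otimes> inv g) ` N" for g
    using NG by (auto simp: \<phi>_def l_coset_def r_coset_def)
  have stab: "g \<in> N" if g: "g \<in> carrier G" "\<phi> g N = N" for g
  proof (rule self[OF g(1)])
    fix x assume x: "x \<in> N"
    have "g \<otimes> x \<otimes> inv g \<in> N"
      using g(2) x \<phi>N[of g] by blast
    moreover obtain y where y: "y \<in> N" "x = g \<otimes> y \<otimes> inv g"
      using g(2) x \<phi>N[of g] by blast
    then have "inv g \<otimes> x \<otimes> g = y"
      using g(1) NG by (simp add: subset_iff m_assoc mult_inv_cancel)
    ultimately show "g \<otimes> x \<otimes> inv g \<in> N \<and> inv g \<otimes> x \<otimes> g \<in> N"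
      using y(1) by simp
  qed
  define S where "S = orbit G \<phi> N"
  have SE: "S \<subseteq> {H. H \<subseteq> carrier G}"
    unfolding S_def using act.element_image NG by (auto simp: orbit_def)
  have finS: "finite S"
    using SE fin by (auto intro: finite_subset[of _ "Pow (carrier G)"])
  have inv: "\<phi> g H \<in> S" if "g \<in> carrier G" "H \<in> S" for g H
    using that NG act.composition_rule[of N g] by (auto simp: S_def orbit_def)
  have NS: "N \<in> S"
    unfolding S_def using act.orbit_refl NG by blast
  define Y where "Y = {H \<in> S. \<exists>g\<in>N. \<phi> g H \<noteq> H}"
  have fix_N: "F = N" if F: "F \<in> S" "F \<notin> Y" for F
  proof -
    obtain g where g: "g \<in> carrier G" "F = \<phi> g N"
      using F(1) by (auto simp: S_def orbit_def)
    have "inv g \<otimes> x \<otimes> g \<in> N" if x: "x \<in> N" for x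
    proof (rule stab)
      have xG: "x \<in> carrier G"
        using x NG by blast
      have "\<phi> x (\<phi> g N) = \<phi> g N"
        using F g x by (auto simp: Y_def)
      then have "\<phi> (inv g \<otimes> (x \<otimes> g)) N = \<phi> (inv g \<otimes> g) N"
        using g(1) xG NG act.composition_rule[of N "inv g" "x \<otimes> g"]
          act.composition_rule[of N x g] act.composition_rule[of N "inv g" g] by simp
      also have "\<dots> = N"
        using g(1) NG act.id_eq_one by (metis l_inv mem_Collect_eq restrict_apply')
      finally show "\<phi> (inv g \<otimes> x \<otimes> g) N = N"
        using g(1) xG by (simp add: m_assoc)
    qed (use g x NG in auto)
    then have sub: "\<phi> (inv g) N \<subseteq> N"
      using g(1) \<phi>N[of "inv g"] by auto
    have "card (\<phi> (inv g) N) = card N"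
      unfolding \<phi>N using g(1) NG
      by (intro card_image inj_onI) (auto simp: subset_iff)
    then have "\<phi> (inv g) N = N"
      using sub NG fin by (meson card_subset_eq finite_subset)
    then have "\<phi> (g \<otimes> inv g) N = \<phi> g N"
      using g(1) NG act.composition_rule[of N g "inv g"] by simp
    then show ?thesis
      using g NG act.id_eq_one by (metis r_inv mem_Collect_eq restrict_apply')
  qed
  have N_fixed: "N \<notin> Y"
  proof -
    have "\<phi> g N = N" if "g \<in> N" for g
    proof -
      have "g <# N = N" "N #> inv g = N"
        using that N NG coset_join3 coset_join2 subgroup.m_inv_closed by (metis subset_iff)+
      then show ?thesis
        using NG by (simp add: \<phi>_def)
    qed
    then show ?thesis
      by (simp add: Y_def)
  qed
  obtain l where l: "card N = p ^ l"
    using lagrange_finite[OF fin N] order p by (metis divides_primepow_nat dvd_triv_right)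
  have "p dvd card Y"
    using group_action.prime_dvd_card_nonfixed_points[OF act.induced_action[OF N] p, of l S]
      l SE finS inv NG by (auto simp: order_def Y_def)
  moreover have "S = insert N Y"
    using fix_N NS by (fastforce simp: Y_def)
  then have "card S = Suc (card Y)"
    using N_fixed finS by simp
  moreover have "card S dvd p ^ n"
    unfolding S_def using act.orbit_stabilizer_theorem[of N] NG order by (metis dvd_triv_left mem_Collect_eq)
  then obtain a where a: "card S = p ^ a"
    using p by (metis divides_primepow_nat)
  ultimately have "a = 0"
    using p by (metis dvd_add_right_iff dvd_power nat_dvd_1_iff_1 not_prime_1 plus_1_eq_Suc add.commute neq0_conv)
  then have "S = {N}"
    using a NS by (metis card_1_singletonE power_0 singletonD)
  then have "\<phi> g N = N" if "g \<in> carrier G" for g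
    using inv[OF that NS] by simp
  then show ?thesis
    using stab NG by blast
qed

section \<open>Elementary abelian subgroups of p-groups\<close>

text \<open>
  Moving a \<open>y\<close> past an \<open>x\<close> costs one factor \<open>z\<close>, which commutes with both; sorting \<open>(x y) ^ n\<close> takes one
  such exchange for every pair of positions.
\<close>

lemma (in group) class_two_power:
  assumes x: "x \<in> carrier G" and y: "y \<in> carrier G" and z: "z \<in> carrier G"
    and yx: "y \<otimes> x = x \<otimes> y \<otimes> z" and zx: "z \<otimes> x = x \<otimes> z" and zy: "z \<otimes> y = y \<otimes> z"
  shows "(x \<otimes> y) [^] n = x [^] n \<otimes> y [^] n \<otimes> z [^] (n choose 2)"
proof -
  note c = x y z
  have zmx: "z [^] m \<otimes> x = x \<otimes> z [^] m" and zmy: "z [^] m \<otimes> y = y \<otimes> z [^] m" for m :: nat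
    using group_commutes_pow zx zy c by blast+
  have ynx: "y [^] m \<otimes> x = x \<otimes> (y [^] m \<otimes> z [^] m)" for m :: nat
  proof (induction m)
    case 0
    then show ?case using c by simp
  next
    case (Suc m)
    have "y [^] Suc m \<otimes> x = y [^] m \<otimes> (y \<otimes> x)"
      using c by (simp add: m_assoc)
    also have "\<dots> = y [^] m \<otimes> x \<otimes> (y \<otimes> z)"
      using c by (simp add: yx m_assoc)
    also have "\<dots> = x \<otimes> (y [^] m \<otimes> (z [^] m \<otimes> y) \<otimes> z)"
      using c by (simp add: Suc.IH m_assoc)
    also have "\<dots> = x \<otimes> (y [^] Suc m \<otimes> z [^] Suc m)"
      using c by (simp add: zmy m_assoc)
    finally show ?case .
  qed
  show ?thesis
  proof (induction n)
    case 0
    then show ?case by (simp add: numeral_2_eq_2)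
  next
    case (Suc n)
    let ?b = "n choose 2"
    have "(x \<otimes> y) [^] Suc n = x [^] n \<otimes> y [^] n \<otimes> (z [^] ?b \<otimes> x) \<otimes> y"
      using c by (simp add: Suc.IH m_assoc)
    also have "\<dots> = x [^] n \<otimes> (y [^] n \<otimes> x) \<otimes> (z [^] ?b \<otimes> y)"
      using c by (simp add: zmx m_assoc)
    also have "\<dots> = x [^] Suc n \<otimes> y [^] n \<otimes> (z [^] n \<otimes> y) \<otimes> z [^] ?b"
      unfolding ynx zmy[of ?b] using c by (simp add: m_assoc)
    also have "\<dots> = x [^] Suc n \<otimes> y [^] Suc n \<otimes> (z [^] n \<otimes> z [^] ?b)"
      unfolding zmy using c by (simp add: m_assoc)
    also have "z [^] n \<otimes> z [^] ?b = z [^] (Suc n choose 2)"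
      using c by (simp add: nat_pow_mult numeral_2_eq_2)
    finally show ?case .
  qed
qed

text \<open>
  The commutator of \<open>e\<close> in \<open>E\<close> and \<open>f\<close> in \<open>F\<close> lies in \<open>E\<close> and in \<open>F\<close>, hence commutes with both, so
  the class two formula applies. Oddness of \<open>p\<close> enters because \<open>p\<close> must divide \<open>p choose 2\<close>.
\<close>

lemma (in group) product_of_mutually_normalizing_abelian_subgroups:
  assumes p: "odd (p :: nat)"
    and E: "subgroup E G" and F: "subgroup F G"
    and Ecomm: "\<And>x y. x \<in> E \<Longrightarrow> y \<in> E \<Longrightarrow> x \<otimes> y = y \<otimes> x"
    and Fcomm: "\<And>x y. x \<in> F \<Longrightarrow> y \<in> F \<Longrightarrow> x \<otimes> y = y \<otimes> x"
    and Eexp: "\<And>x. x \<in> E \<Longrightarrow> x [^] p = \<one>" and Fexp: "\<And>x. x \<in> F \<Longrightarrow> x [^] p = \<one>"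
    and EF: "\<And>e f. e \<in> E \<Longrightarrow> f \<in> F \<Longrightarrow> e \<otimes> f \<otimes> inv e \<in> F"
    and FE: "\<And>e f. e \<in> E \<Longrightarrow> f \<in> F \<Longrightarrow> f \<otimes> e \<otimes> inv f \<in> E"
  shows "subgroup (E <#> F) G" and "\<And>x. x \<in> E <#> F \<Longrightarrow> x [^] p = \<one>"
proof -
  have c: "x \<in> carrier G" if "x \<in> E \<or> x \<in> F" for x
    using that E F subgroup.mem_carrier by metis
  show "subgroup (E <#> F) G"
  proof (rule subgroupI)
    show "E <#> F \<subseteq> carrier G"
      using c by (auto simp: set_mult_def)
    show "E <#> F \<noteq> {}"
      using E F subgroup.one_closed by (fastforce simp: set_mult_def)
  next
    fix a assume "a \<in> E <#> F"
    then obtain e f where a: "e \<in> E" "f \<in> F" "a = e \<otimes> f"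
      by (auto simp: set_mult_def)
    have "inv a = (inv f \<otimes> inv e \<otimes> inv (inv f)) \<otimes> inv f"
      using a c by (simp add: inv_mult_group m_assoc)
    moreover have "inv f \<otimes> inv e \<otimes> inv (inv f) \<in> E"
      using a E F by (intro FE) (auto intro: subgroup.m_inv_closed)
    ultimately show "inv a \<in> E <#> F"
      using a F by (auto simp: set_mult_def intro: subgroup.m_inv_closed)
  next
    fix a b assume "a \<in> E <#> F" "b \<in> E <#> F"
    then obtain e f e' f' where a: "e \<in> E" "f \<in> F" "a = e \<otimes> f" and b: "e' \<in> E" "f' \<in> F" "b = e' \<otimes> f'"
      by (auto simp: set_mult_def)
    have "a \<otimes> b = e \<otimes> (f \<otimes> e' \<otimes> inv f) \<otimes> (f \<otimes> f')"
    using a b c by (simp add: m_assoc mult_inv_cancel)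
    moreover have "e \<otimes> (f \<otimes> e' \<otimes> inv f) \<in> E"
      using subgroup.m_closed[OF E a(1) FE[OF b(1) a(2)]] .
    moreover have "f \<otimes> f' \<in> F"
      using a b F by (intro subgroup.m_closed)
    ultimately show "a \<otimes> b \<in> E <#> F"
      by (auto simp: set_mult_def)
  qed
  show "x [^] p = \<one>" if "x \<in> E <#> F" for x
  proof -
    obtain e f where x: "e \<in> E" "f \<in> F" "x = e \<otimes> f"
      using \<open>x \<in> E <#> F\<close> by (auto simp: set_mult_def)
    have ef: "e \<in> carrier G" "f \<in> carrier G"
      using x c by auto
    define z where "z = inv f \<otimes> inv e \<otimes> f \<otimes> e"
    have "inv f \<otimes> inv e \<otimes> inv (inv f) \<in> E"
      using x E F by (intro FE) (auto intro: subgroup.m_inv_closed)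
    then have zE: "z \<in> E"
      using x E ef by (simp add: z_def subgroup.m_closed)
    have "inv e \<otimes> f \<otimes> inv (inv e) \<in> F"
      using x E F by (intro EF) (auto intro: subgroup.m_inv_closed)
    then have "inv f \<otimes> (inv e \<otimes> f \<otimes> e) \<in> F"
      using x F ef by (simp add: subgroup.m_closed subgroup.m_inv_closed)
    then have zF: "z \<in> F"
      using ef by (simp add: z_def m_assoc)
    have "f \<otimes> e = e \<otimes> f \<otimes> z"
      using ef by (simp add: z_def m_assoc mult_inv_cancel)
    then have "x [^] p = e [^] p \<otimes> f [^] p \<otimes> z [^] (p choose 2)"
      unfolding x(3) using ef c zE Ecomm[OF zE x(1)] Fcomm[OF zF x(2)] by (intro class_two_power) auto
    also have "p choose 2 = p * ((p - 1) div 2)"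
      using p by (simp add: choose_two div_mult_swap)
    also have "z [^] (p * ((p - 1) div 2)) = \<one>"
      using zE c Eexp by (simp flip: nat_pow_pow)
    finally show "x [^] p = \<one>"
      using x Eexp Fexp by simp
  qed
qed

text \<open>
  If \<open>g\<close> normalizes the normalizer \<open>N\<close> of \<open>E\<close>, then \<open>E\<close> and its conjugate \<open>F\<close> by \<open>g\<close> are both normal
  in \<open>N\<close>, so \<open>E F\<close> has exponent \<open>p\<close> and maximality gives \<open>F = E\<close>, that is, \<open>g \<in> N\<close>. Thus \<open>N\<close> is
  self-normalizing, and in a \<open>p\<close>-group this means that it is everything.
\<close>

lemma (in group) maximal_elementary_abelian_subgroup_normal:
  assumes p: "Factorial_Ring.prime (p :: nat)" "odd p" and order: "Coset.order G = p ^ n"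
    and E: "subgroup E G"
    and Ecomm: "\<And>x y. x \<in> E \<Longrightarrow> y \<in> E \<Longrightarrow> x \<otimes> y = y \<otimes> x"
    and Eexp: "\<And>x. x \<in> E \<Longrightarrow> x [^] p = \<one>"
    and max: "\<And>S. subgroup S G \<Longrightarrow> (\<And>x. x \<in> S \<Longrightarrow> x [^] p = \<one>) \<Longrightarrow> E \<subseteq> S \<Longrightarrow> S = E"
    and g: "g \<in> carrier G" and x: "x \<in> E"
  shows "g \<otimes> x \<otimes> inv g \<in> E"
proof -
  have EG: "y \<in> carrier G" if "y \<in> E" for y
    using that E subgroup.mem_carrier by metis
  have fin: "finite (carrier G)"
    using order p prime_gt_0_nat by (metis card_gt_0_iff order_def zero_less_power)
  then have finE: "finite E"
    using E finite_subset subgroup.subset by metis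
  define N where "N = {g \<in> carrier G. (\<lambda>x. g \<otimes> x \<otimes> inv g) ` E = E}"
  have NI: "g \<in> N" if g: "g \<in> carrier G" and sub: "\<And>x. x \<in> E \<Longrightarrow> g \<otimes> x \<otimes> inv g \<in> E" for g
  proof -
    have "inj_on (\<lambda>x. g \<otimes> x \<otimes> inv g) E"
      using g EG by (auto simp: inj_on_def)
    then have "(\<lambda>x. g \<otimes> x \<otimes> inv g) ` E = E"
      using finE sub by (intro endo_inj_surj) auto
    then show ?thesis
      using g by (simp add: N_def)
  qed
  have ND: "g \<otimes> x \<otimes> inv g \<in> E" if "g \<in> N" "x \<in> E" for g x
    using that by (auto simp: N_def)
  have ND': "inv g \<otimes> x \<otimes> g \<in> E" if "g \<in> N" "x \<in> E" for g x
  proof -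
    have "x \<in> (\<lambda>x. g \<otimes> x \<otimes> inv g) ` E"
      using that by (simp add: N_def)
    then obtain y where y: "y \<in> E" "x = g \<otimes> y \<otimes> inv g"
      by blast
    then have "inv g \<otimes> x \<otimes> g = y"
      using that EG by (simp add: N_def m_assoc mult_inv_cancel)
    then show ?thesis
      using y by simp
  qed
  have NG: "y \<in> carrier G" if "y \<in> N" for y
    using that by (simp add: N_def)
  have EN: "y \<in> N" if "y \<in> E" for y
    using that E EG by (intro NI) (auto intro!: subgroup.m_closed subgroup.m_inv_closed)
  have N: "subgroup N G"
  proof (rule subgroupI)
    show "N \<subseteq> carrier G"
      using NG by blast
    show "N \<noteq> {}"
      using EN x by blast
  next
    fix a assume "a \<in> N"
    then show "inv a \<in> N"
      using ND' NG by (intro NI) auto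
  next
    fix a b assume ab: "a \<in> N" "b \<in> N"
    have "a \<otimes> b \<otimes> y \<otimes> inv (a \<otimes> b) = a \<otimes> (b \<otimes> y \<otimes> inv b) \<otimes> inv a" if "y \<in> E" for y
      using ab NG EG[OF that] by (simp add: inv_mult_group m_assoc)
    then show "a \<otimes> b \<in> N"
      using ab NG ND by (intro NI) auto
  qed
  have "N = carrier G"
  proof (rule self_normalizing_subgroup_eq_carrier[OF p(1) order N])
    fix g assume g: "g \<in> carrier G"
      and gN: "\<And>x. x \<in> N \<Longrightarrow> g \<otimes> x \<otimes> inv g \<in> N \<and> inv g \<otimes> x \<otimes> g \<in> N"
    let ?c = "\<lambda>x. g \<otimes> x \<otimes> inv g"
    define F where "F = ?c ` E"
    have c_mult: "?c (a \<otimes> b) = ?c a \<otimes> ?c b" if "a \<in> carrier G" "b \<in> carrier G" for a b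
    using g that by (simp add: m_assoc mult_inv_cancel)
    then have "?c \<in> hom G G"
      using g by (auto simp: hom_def)
    then interpret c: group_hom G G ?c
      by (simp add: group_hom_def group_hom_axioms_def)
    have F: "subgroup F G"
      unfolding F_def using E by (rule c.subgroup_img_is_subgroup)
    have Fcomm: "a \<otimes> b = b \<otimes> a" if ab: "a \<in> F" "b \<in> F" for a b
    proof -
      obtain a' b' where a': "a' \<in> E" "a = ?c a'" and b': "b' \<in> E" "b = ?c b'"
        using ab unfolding F_def by blast
      have "?c (a' \<otimes> b') = ?c (b' \<otimes> a')"
        using Ecomm[OF a'(1) b'(1)] by simp
      then show ?thesis
        unfolding a'(2) b'(2) using a'(1) b'(1) EG by (simp only: c_mult)
    qed
    have Fexp: "a [^] p = \<one>" if a: "a \<in> F" for a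
    proof -
      obtain y where y: "y \<in> E" "a = ?c y"
        using a unfolding F_def by blast
      have "?c y [^] p = ?c (y [^] p)"
        using c.hom_nat_pow[OF EG[OF y(1)], of p] by simp
      then show ?thesis
        using y Eexp g by simp
    qed
    have EF: "e \<otimes> f \<otimes> inv e \<in> F" and FE: "f \<otimes> e \<otimes> inv f \<in> E" if e: "e \<in> E" and f: "f \<in> F" for e f
    proof -
      obtain y where y: "y \<in> E" "f = ?c y"
        using f unfolding F_def by blast
      define a where "a = inv g \<otimes> e \<otimes> g"
      have a: "a \<in> N"
        using gN[OF EN[OF e]] by (simp add: a_def)
      have ca: "?c a = e"
        using g EG[OF e] by (simp add: a_def m_assoc mult_inv_cancel)
      have "?c (a \<otimes> y \<otimes> inv a) = ?c a \<otimes> ?c y \<otimes> inv (?c a)"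
        using NG[OF a] EG[OF y(1)] by (simp only: c_mult m_closed inv_closed c.hom_inv)
      then show "e \<otimes> f \<otimes> inv e \<in> F"
        using ND[OF a y(1)] by (metis F_def ca imageI y(2))
      have "f \<in> N"
        using gN EN y by simp
      then show "f \<otimes> e \<otimes> inv f \<in> E"
        using ND e by blast
    qed
    note prod = product_of_mutually_normalizing_abelian_subgroups
      [OF p(2) E F Ecomm Fcomm Eexp Fexp EF FE]
    have "E \<subseteq> E <#> F"
      using subgroup.one_closed[OF F] EG by (force simp: set_mult_def)
    then have "E <#> F = E"
      using max prod by blast
    moreover have "F \<subseteq> E <#> F"
      using subgroup.one_closed[OF E] subgroup.mem_carrier[OF F] by (force simp: set_mult_def)
    ultimately show "g \<in> N"
      using g by (intro NI) (auto simp: F_def)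
  qed
  then show ?thesis
    using ND g x by blast
qed

section \<open>Elementary abelian and Heisenberg groups\<close>

definition elementary_abelian_group :: "nat \<Rightarrow> nat \<Rightarrow> (nat \<Rightarrow> int) monoid" where
  "elementary_abelian_group p n = product_group {..<n} (\<lambda>_. integer_mod_group p)"

lemma elementary_abelian_group:
  assumes "p > 0"
  shows "group (elementary_abelian_group p n)"
    and "Coset.order (elementary_abelian_group p n) = p ^ n"
    and "x \<in> carrier (elementary_abelian_group p n) \<Longrightarrow> x [^]\<^bsub>elementary_abelian_group p n\<^esub> p = \<one>\<^bsub>elementary_abelian_group p n\<^esub>"
    and "x \<otimes>\<^bsub>elementary_abelian_group p n\<^esub> y = y \<otimes>\<^bsub>elementary_abelian_group p n\<^esub> x"
proof -
  let ?V = "elementary_abelian_group p n"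
  show "group ?V"
    by (simp add: elementary_abelian_group_def)
  show "Coset.order ?V = p ^ n"
    using assms by (simp add: elementary_abelian_group_def order_def card_PiE carrier_integer_mod_group)
  have "x [^]\<^bsub>?V\<^esub> m = (\<lambda>i\<in>{..<n}. x i [^]\<^bsub>integer_mod_group p\<^esub> m)" for m :: nat
    by (induction m) (auto simp: elementary_abelian_group_def)
  then show "x [^]\<^bsub>?V\<^esub> p = \<one>\<^bsub>?V\<^esub>"
    by (simp add: elementary_abelian_group_def)
  show "x \<otimes>\<^bsub>?V\<^esub> y = y \<otimes>\<^bsub>?V\<^esub> x"
    by (simp add: elementary_abelian_group_def add.commute)
qed

text \<open>
  The triple \<open>(a, b, c)\<close> stands for the upper unitriangular matrix of size three with \<open>a\<close> and \<open>b\<close> on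
  the superdiagonal and \<open>c\<close> in the corner.
\<close>

definition heisenberg_group :: "nat \<Rightarrow> (int \<times> int \<times> int) monoid" where
  "heisenberg_group p = \<lparr>carrier = {0..<int p} \<times> {0..<int p} \<times> {0..<int p},
     monoid.mult = (\<lambda>(a, b, c) (a', b', c'). ((a + a') mod p, (b + b') mod p, (c + c' + a * b') mod p)),
     one = (0, 0, 0)\<rparr>"

lemma heisenberg_group:
  assumes p: "p > 1"
  shows "group (heisenberg_group p)"
    and "Coset.order (heisenberg_group p) = p ^ 3"
    and "odd p \<Longrightarrow> x \<in> carrier (heisenberg_group p) \<Longrightarrow> x [^]\<^bsub>heisenberg_group p\<^esub> p = \<one>\<^bsub>heisenberg_group p\<^esub>"
    and "\<exists>x\<in>carrier (heisenberg_group p). \<exists>y\<in>carrier (heisenberg_group p).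
      x \<otimes>\<^bsub>heisenberg_group p\<^esub> y \<noteq> y \<otimes>\<^bsub>heisenberg_group p\<^esub> x"
proof -
  let ?H = "heisenberg_group p"
  show "group ?H"
  proof (rule groupI)
    fix x y z assume "x \<in> carrier ?H" "y \<in> carrier ?H" "z \<in> carrier ?H"
    obtain a b c a' b' c' a'' b'' c'' where xyz: "x = (a, b, c)" "y = (a', b', c')" "z = (a'', b'', c'')"
      by (metis prod_cases3)
    have "((c + c' + a * b') mod p + c'' + ((a + a') mod p) * b'') mod int p
        = (c + c' + a * b' + c'' + (a + a') * b'') mod int p"
      by (intro mod_add_cong) (simp_all add: mod_simps)
    also have "\<dots> = (c + (c' + c'' + a' * b'') + a * (b' + b'')) mod int p"
      by (simp add: algebra_simps)
    also have "\<dots> = (c + (c' + c'' + a' * b'') mod p + a * ((b' + b'') mod p)) mod int p"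
      by (intro mod_add_cong) (simp_all add: mod_simps)
    finally show "x \<otimes>\<^bsub>?H\<^esub> y \<otimes>\<^bsub>?H\<^esub> z = x \<otimes>\<^bsub>?H\<^esub> (y \<otimes>\<^bsub>?H\<^esub> z)"
      by (simp add: heisenberg_group_def xyz mod_simps add.assoc)
  next
    fix x assume x: "x \<in> carrier ?H"
    obtain a b c where abc: "x = (a, b, c)" by (cases x)
    have "((a * b - c) mod p + c + ((- a) mod p) * b) mod int p = (a * b - c + c + (- a) * b) mod int p"
      by (intro mod_add_cong) (simp_all add: mod_simps)
    then show "\<exists>y\<in>carrier ?H. y \<otimes>\<^bsub>?H\<^esub> x = \<one>\<^bsub>?H\<^esub>"
      using p by (intro bexI[of _ "((- a) mod p, (- b) mod p, (a * b - c) mod p)"])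
        (auto simp: heisenberg_group_def abc mod_simps)
  qed (use p in \<open>auto simp: heisenberg_group_def\<close>)
  show "Coset.order ?H = p ^ 3"
    by (simp add: heisenberg_group_def order_def card_cartesian_product power3_eq_cube)
  show "x [^]\<^bsub>?H\<^esub> p = \<one>\<^bsub>?H\<^esub>" if "odd p"
  proof -
    obtain a b c where abc: "x = (a, b, c)" by (cases x)
    \<comment> \<open>The corner entry of a power has the coefficient \<open>m choose 2\<close>, which for an odd \<open>m = p\<close> is a
      multiple of \<open>p\<close>; modulo \<open>2\<close> the group has elements of order four.\<close>
    have pow: "x [^]\<^bsub>?H\<^esub> m = (m * a mod p, m * b mod p, (m * c + (m choose 2) * (a * b)) mod p)" for m :: nat
    proof (induction m)
      case 0
      then show ?case by (simp add: heisenberg_group_def numeral_2_eq_2)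
    next
      case (Suc m)
      have "((m * c + (m choose 2) * (a * b)) mod p + c + (m * a mod p) * b) mod int p
          = (m * c + (m choose 2) * (a * b) + c + m * a * b) mod int p"
        by (intro mod_add_cong) (simp_all add: mod_simps)
      also have "m * c + (m choose 2) * (a * b) + c + m * a * b = Suc m * c + (Suc m choose 2) * (a * b)"
        by (simp add: numeral_2_eq_2 algebra_simps)
      finally have "((m * c + (m choose 2) * (a * b)) mod p + c + (m * a mod p) * b) mod int p
          = (Suc m * c + (Suc m choose 2) * (a * b)) mod int p" .
      moreover have "x [^]\<^bsub>?H\<^esub> Suc m
          = ((m * a mod p + a) mod p, (m * b mod p + b) mod p,
             ((m * c + (m choose 2) * (a * b)) mod p + c + (m * a mod p) * b) mod p)"
        unfolding nat_pow_Suc Suc.IH by (simp add: heisenberg_group_def abc)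
      ultimately show ?case
        by (simp add: mod_simps distrib_right add.commute)
    qed
    have "p choose 2 = p * ((p - 1) div 2)"
      using \<open>odd p\<close> by (simp add: choose_two div_mult_swap)
    then show ?thesis
      using pow[of p] by (simp add: heisenberg_group_def mult.assoc flip: distrib_left)
  qed
  show "\<exists>x\<in>carrier ?H. \<exists>y\<in>carrier ?H. x \<otimes>\<^bsub>?H\<^esub> y \<noteq> y \<otimes>\<^bsub>?H\<^esub> x"
    using p by (intro bexI[of _ "(1, 0, 0)"] bexI[of _ "(0, 1, 0)"]) (auto simp: heisenberg_group_def)
qed

lemma nat_pow_DirProd: "x [^]\<^bsub>G \<times>\<times> H\<^esub> (n :: nat) = (fst x [^]\<^bsub>G\<^esub> n, snd x [^]\<^bsub>H\<^esub> n)"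
  by (induction n) (auto simp: mult_DirProd')

lemma nonabelian_group_of_odd_prime_exponent:
  assumes p: "p > 1" "odd p" and n: "n \<ge> 3"
  obtains K :: "((int \<times> int \<times> int) \<times> (nat \<Rightarrow> int)) monoid"
  where "group K" and "Coset.order K = p ^ n" and "\<And>x. x \<in> carrier K \<Longrightarrow> x [^]\<^bsub>K\<^esub> p = \<one>\<^bsub>K\<^esub>"
    and "\<exists>x\<in>carrier K. \<exists>y\<in>carrier K. x \<otimes>\<^bsub>K\<^esub> y \<noteq> y \<otimes>\<^bsub>K\<^esub> x"
proof
  let ?H = "heisenberg_group p" and ?V = "elementary_abelian_group p (n - 3)"
  have p0: "p > 0" using p by simp
  note H = heisenberg_group[OF p(1)] and V = elementary_abelian_group[OF p0, where n = "n - 3"]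
  show "group (?H \<times>\<times> ?V)"
    using H(1) V(1) by (rule DirProd_group)
  show "Coset.order (?H \<times>\<times> ?V) = p ^ n"
    using H(2) V(2) n by (simp add: order_def card_cartesian_product flip: power_add)
  show "x [^]\<^bsub>?H \<times>\<times> ?V\<^esub> p = \<one>\<^bsub>?H \<times>\<times> ?V\<^esub>" if "x \<in> carrier (?H \<times>\<times> ?V)" for x
    using that H(3) V(3) p by (auto simp: nat_pow_DirProd)
  obtain x y where xy: "x \<in> carrier ?H" "y \<in> carrier ?H" "x \<otimes>\<^bsub>?H\<^esub> y \<noteq> y \<otimes>\<^bsub>?H\<^esub> x"
    using H(4) by blast
  then show "\<exists>x\<in>carrier (?H \<times>\<times> ?V). \<exists>y\<in>carrier (?H \<times>\<times> ?V).
      x \<otimes>\<^bsub>?H \<times>\<times> ?V\<^esub> y \<noteq> y \<otimes>\<^bsub>?H \<times>\<times> ?V\<^esub> x"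
    using group.is_monoid[OF V(1)] monoid.one_closed
    by (intro bexI[of _ "(x, \<one>\<^bsub>?V\<^esub>)"] bexI[of _ "(y, \<one>\<^bsub>?V\<^esub>)"]) auto
qed

section \<open>p-groups with a large cyclic and a large elementary abelian subgroup\<close>

text \<open>
  The subgroup generated by \<open>c\<close> has only \<open>p\<close> elements \<open>y\<close> with \<open>y ^ p = 1\<close>, namely the powers of
  \<open>c ^ m\<close>. So distinct exponents below \<open>m\<close> give distinct cosets of \<open>S\<close>, which makes the product of
  \<open>S\<close> with the powers of \<open>c\<close> at least \<open>m\<close> times as large as \<open>S\<close>.
\<close>

lemma (in group) inj_on_subgroup_times_powers:
  assumes S: "subgroup S G" and Sexp: "\<And>x. x \<in> S \<Longrightarrow> x [^] p = \<one>"
    and c: "c \<in> carrier G" and ord: "ord c = p * m" and p: "p > 0"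
  shows "inj_on (\<lambda>(s, i). s \<otimes> c [^] i) (S \<times> {..<m})"
proof -
  have SG: "s \<in> carrier G" if "s \<in> S" for s
    using that S subgroup.mem_carrier by metis
  have *: "s = t \<and> i = j"
    if st: "s \<in> S" "t \<in> S" and ij: "i \<le> j" "j < m" and eq: "s \<otimes> c [^] i = t \<otimes> c [^] j" for s t and i j :: nat
  proof -
    have "c [^] j = c [^] (j - i) \<otimes> c [^] i"
      using ij c by (simp add: nat_pow_mult)
    then have s: "s = t \<otimes> c [^] (j - i)"
      using eq st SG c by (simp flip: m_assoc)
    then have "c [^] (j - i) = inv t \<otimes> s"
      using st SG c by (simp flip: m_assoc)
    then have "c [^] (j - i) \<in> S"
      using st S by (simp add: subgroup.m_closed subgroup.m_inv_closed)
    then have "c [^] ((j - i) * p) = \<one>"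
      using Sexp c by (simp flip: nat_pow_pow)
    then have "p * m dvd (j - i) * p"
      using c ord by (simp add: pow_eq_id)
    then have "m dvd j - i"
      using p by (simp add: mult.commute)
    moreover have "j - i < m"
      using ij by linarith
    ultimately have "j - i = 0"
      using nat_dvd_not_less[of "j - i" m] by blast
    then have "i = j"
      using ij by linarith
    then show ?thesis
      using s st SG by simp
  qed
  show ?thesis
  proof (rule inj_onI)
    fix u v
    assume uv: "u \<in> S \<times> {..<m}" "v \<in> S \<times> {..<m}"
      and eq: "(case u of (s, i) \<Rightarrow> s \<otimes> c [^] i) = (case v of (s, i) \<Rightarrow> s \<otimes> c [^] i)"
    obtain s i t j where "u = (s, i)" "v = (t, j)"
      by (metis surj_pair)
    then show "u = v"
      using uv eq *[of s t i j] *[of t s j i] by (cases "i \<le> j") auto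
  qed
qed

text \<open>
  The quotient by the normal subgroup \<open>E\<close> maps \<open>e \<otimes> y\<close> and \<open>y\<close>, and hence their powers, to the same
  element.
\<close>

lemma (in group) normal_coset_power:
  assumes E: "subgroup E G" and norm: "\<And>g x. g \<in> carrier G \<Longrightarrow> x \<in> E \<Longrightarrow> g \<otimes> x \<otimes> inv g \<in> E"
    and e: "e \<in> E" and y: "y \<in> carrier G"
  shows "\<exists>e'\<in>E. (e \<otimes> y) [^] (n :: nat) = e' \<otimes> y [^] n"
proof (induction n)
  case 0
  then show ?case using subgroup.one_closed[OF E] by force
next
  case (Suc n)
  then obtain e' where e': "e' \<in> E" "(e \<otimes> y) [^] n = e' \<otimes> y [^] n" by blast
  have c: "e \<in> carrier G" "e' \<in> carrier G"
    using e e' E subgroup.mem_carrier by metis+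
  have "(e \<otimes> y) [^] Suc n = e' \<otimes> (y [^] n \<otimes> e \<otimes> inv (y [^] n)) \<otimes> y [^] Suc n"
    using c y by (simp add: e' m_assoc mult_inv_cancel)
  moreover have "e' \<otimes> (y [^] n \<otimes> e \<otimes> inv (y [^] n)) \<in> E"
    using subgroup.m_closed[OF E e'(1)] norm e y by simp
  ultimately show ?case by blast
qed

lemma le_power_minus_two:
  assumes "p \<ge> 3" and "k \<ge> 3"
  shows "k \<le> (p :: nat) ^ (k - 2)"
  using assms(2)
proof (induction k rule: dec_induct)
  case base
  then show ?case using assms(1) by simp
next
  case (step k)
  have "Suc k \<le> p * k"
    using step.hyps assms(1) mult_le_mono1[of 3 p k] by linarith
  also have "\<dots> \<le> p * p ^ (k - 2)"
    using step.IH by simp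
  also have "\<dots> = p ^ Suc (k - 2)"
    by simp
  also have "Suc (k - 2) = Suc k - 2"
    using step.hyps(1) by linarith
  finally show ?case .
qed

text \<open>
  By counting, \<open>E\<close> is a maximal subgroup of exponent \<open>p\<close>, hence normal, and every element has the
  form \<open>e \<otimes> c [^] i\<close> with \<open>e \<in> E\<close>. The power \<open>d\<close> of \<open>c\<close> with exponent \<open>p ^ (k - 2)\<close> serves two
  purposes: it is high enough to centralize \<open>E\<close>, because \<open>k \<le> p ^ (k - 2)\<close>, and low enough that
  every element \<open>x\<close> with \<open>x ^ p = 1\<close> lies in \<open>E\<close> times the powers of \<open>d\<close>.
\<close>

lemma (in group) elements_of_order_p_commute:
  assumes p: "Factorial_Ring.prime (p :: nat)" "odd p" and k: "k \<ge> 3"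
    and order: "Coset.order G = p ^ (2 * k - 1)"
    and c: "c \<in> carrier G" and ord: "ord c = p ^ k"
    and E: "subgroup E G" and cardE: "card E = p ^ k"
    and Ecomm: "\<And>x y. x \<in> E \<Longrightarrow> y \<in> E \<Longrightarrow> x \<otimes> y = y \<otimes> x"
    and Eexp: "\<And>x. x \<in> E \<Longrightarrow> x [^] p = \<one>"
    and x: "x \<in> carrier G" "x [^] p = \<one>" and y: "y \<in> carrier G" "y [^] p = \<one>"
  shows "x \<otimes> y = y \<otimes> x"
proof -
  have EG: "e \<in> carrier G" if "e \<in> E" for e
    using that E subgroup.mem_carrier by metis
  have p0: "p > 0"
    using p(1) by (rule prime_gt_0_nat)
  have p3: "p \<ge> 3"
    using p prime_ge_2_nat[of p] by (cases "p = 2") auto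
  have fin: "finite (carrier G)"
    using order p0 by (metis card_gt_0_iff order_def zero_less_power)
  define m where "m = p ^ (k - 1)"
  have m0: "m > 0"
    using p0 by (simp add: m_def)
  have ord_m: "ord c = p * m"
    using ord k by (simp add: m_def flip: power_Suc)
  have order_m: "Coset.order G = p ^ k * m"
  proof -
    have "2 * k - 1 = k + (k - 1)"
      using k by linarith
    then show ?thesis
      by (simp only: order m_def power_add)
  qed
  have inj: "inj_on (\<lambda>(s, i). s \<otimes> c [^] i) (S \<times> {..<m})"
    if "subgroup S G" "\<And>x. x \<in> S \<Longrightarrow> x [^] p = \<one>" for S
    using inj_on_subgroup_times_powers[OF that(1) _ c ord_m p0] that(2) by blast
  have sub: "(\<lambda>(s, i). s \<otimes> c [^] i) ` (S \<times> {..<m}) \<subseteq> carrier G" if "subgroup S G" for S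
    using subgroup.mem_carrier[OF that] c by auto
  have bound: "card S \<le> p ^ k" if "subgroup S G" "\<And>x. x \<in> S \<Longrightarrow> x [^] p = \<one>" for S
  proof -
    have "card (S \<times> {..<m}) \<le> card (carrier G)"
      using inj[OF that] sub[OF that(1)] fin by (intro card_inj_on_le)
    then show ?thesis
      using order_m m0 by (simp add: order_def card_cartesian_product)
  qed
  have decomp: "\<exists>e\<in>E. \<exists>i. g = e \<otimes> c [^] (i :: nat)" if "g \<in> carrier G" for g
  proof -
    have "card ((\<lambda>(s, i). s \<otimes> c [^] i) ` (E \<times> {..<m})) = card (carrier G)"
      using card_image[OF inj[OF E Eexp]] cardE order_m by (simp add: order_def card_cartesian_product)
    then have "(\<lambda>(s, i). s \<otimes> c [^] i) ` (E \<times> {..<m}) = carrier G"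
      using sub[OF E] fin by (intro card_subset_eq)
    then show ?thesis
      using that by force
  qed
  have norm: "g \<otimes> e \<otimes> inv g \<in> E" if "g \<in> carrier G" "e \<in> E" for g e
  proof (rule maximal_elementary_abelian_subgroup_normal[OF p order E Ecomm Eexp _ that])
    fix S assume S: "subgroup S G" "\<And>x. x \<in> S \<Longrightarrow> x [^] p = \<one>" "E \<subseteq> S"
    have "finite S"
      using S(1) fin finite_subset subgroup.subset by metis
    then show "S = E"
      using bound[OF S(1,2)] S(3) cardE card_seteq by metis
  qed
  define d where "d = c [^] (p ^ (k - 2))"
  have d: "d \<in> carrier G"
    using c by (simp add: d_def)
  have dE: "d \<otimes> e = e \<otimes> d" if e: "e \<in> E" for e
  proof -
    let ?E = "G\<lparr>carrier := E\<rparr>" and ?T = "\<lambda>x. c \<otimes> x \<otimes> inv c"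
    interpret E: group ?E
      using E by (rule subgroup_imp_group)
    interpret E: comm_group ?E
      by (rule E.group_comm_groupI) (simp add: Ecomm)
    have T: "?T \<in> hom ?E ?E"
      using c norm EG by (auto simp: hom_def m_assoc mult_inv_cancel)
    have Tn: "(?T ^^ n) a = c [^] n \<otimes> a \<otimes> inv (c [^] n)" if "a \<in> E" for n a
    proof (induction n)
      case 0
      then show ?case using EG[OF that] by simp
    next
      case (Suc n)
      have "c \<otimes> c [^] n = c [^] Suc n"
        using c group_commutes_pow[of c c n] by simp
      have "(?T ^^ Suc n) a = c \<otimes> c [^] n \<otimes> a \<otimes> (inv (c [^] n) \<otimes> inv c)"
        using c EG[OF that] Suc.IH by (simp add: m_assoc)
      also have "inv (c [^] n) \<otimes> inv c = inv (c \<otimes> c [^] n)"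
        using c by (simp add: inv_mult_group)
      finally show ?case
        by (simp only: \<open>c \<otimes> c [^] n = c [^] Suc n\<close>)
    qed
    have "(?T ^^ (p ^ (k - 2))) e = e"
    proof (rule E.p_power_order_endomorphism[OF p(1) _ _ T])
      show "Coset.order ?E = p ^ k"
        using cardE by (simp add: order_def)
      show "a [^]\<^bsub>?E\<^esub> p = \<one>\<^bsub>?E\<^esub>" if "a \<in> carrier ?E" for a
        using that Eexp by (simp flip: nat_pow_consistent)
      show "(?T ^^ (p ^ k)) a = a" if "a \<in> carrier ?E" for a
        using that Tn[of a] EG[of a] pow_ord_eq_1[OF c] ord by simp
      show "k \<le> p ^ (k - 2)"
        using p3 k by (rule le_power_minus_two)
    qed (use e in simp)
    then have "e = d \<otimes> e \<otimes> inv d"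
      using Tn[OF e] by (simp add: d_def)
    then show ?thesis
      using d EG[OF e] by (metis inv_solve_right m_closed)
  qed
  have in_Ed: "\<exists>e\<in>E. \<exists>l. g = e \<otimes> d [^] (l :: nat)" if g: "g \<in> carrier G" "g [^] p = \<one>" for g
  proof -
    obtain e i where e: "e \<in> E" "g = e \<otimes> c [^] (i :: nat)"
      using decomp[OF g(1)] by blast
    obtain e' where e': "e' \<in> E" "g [^] p = e' \<otimes> (c [^] i) [^] p"
      using normal_coset_power[OF E norm e(1), of "c [^] i" p] c e(2) by auto
    then have "(c [^] i) [^] p = inv e'"
      using g(2) c EG by (metis inv_equality inv_inv nat_pow_closed inv_closed inv_comm)
    \<comment> \<open>Since \<open>E\<close> has exponent \<open>p\<close>, raising \<open>c ^ (i p)\<close> to the power \<open>p\<close> once more kills it.\<close>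
    then have "(c [^] i) [^] p \<in> E"
      using e'(1) E by (simp add: subgroup.m_inv_closed)
    then have "c [^] (i * p * p) = \<one>"
      using Eexp c by (simp flip: nat_pow_pow)
    then have "p ^ k dvd i * p * p"
      using c ord by (simp add: pow_eq_id)
    moreover have "p ^ k = p ^ (k - 2) * p * p"
    proof -
      have "k = k - 2 + 2"
        using k by linarith
      then have "p ^ k = p ^ (k - 2 + 2)"
        by (rule arg_cong)
      then show ?thesis
        by (simp only: power_add power2_eq_square mult.assoc)
    qed
    ultimately have "p ^ (k - 2) dvd i"
      using p0 by simp
    then obtain l where "i = p ^ (k - 2) * l" ..
    then have "c [^] i = d [^] l"
      using c by (simp add: d_def nat_pow_pow)
    then show ?thesis
      using e by auto
  qed
  obtain e l where e: "e \<in> E" "x = e \<otimes> d [^] (l :: nat)"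
    using in_Ed[OF x] by blast
  obtain e' l' where e': "e' \<in> E" "y = e' \<otimes> d [^] (l' :: nat)"
    using in_Ed[OF y] by blast
  have comm: "d [^] n \<otimes> a = a \<otimes> d [^] n" if "a \<in> E" for a and n :: nat
    using group_commutes_pow[OF dE[OF that] d EG[OF that]] .
  have "a \<otimes> d [^] i \<otimes> (b \<otimes> d [^] j) = a \<otimes> b \<otimes> d [^] (i + j)"
    if "a \<in> E" "b \<in> E" for a b and i j :: nat
  proof -
    have "a \<otimes> d [^] i \<otimes> (b \<otimes> d [^] j) = a \<otimes> (d [^] i \<otimes> b) \<otimes> d [^] j"
      using d that EG by (simp add: m_assoc)
    also have "\<dots> = a \<otimes> b \<otimes> (d [^] i \<otimes> d [^] j)"
      unfolding comm[OF that(2)] using d that EG by (simp add: m_assoc)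
    finally show ?thesis
      using d by (simp add: nat_pow_mult)
  qed
  then show ?thesis
    using e e' Ecomm[OF e(1) e'(1)] by (simp add: add.commute)
qed

lemma embeds_inE:
  assumes "embeds_in K G" and "group K" and "group G"
  obtains f where "group_hom K G f" and "inj_on f (carrier K)"
proof -
  obtain H f where H: "subgroup H G" and f: "f \<in> iso K (G\<lparr>carrier := H\<rparr>)"
    using assms(1) by (auto simp: embeds_in_def is_iso_def)
  have "f \<in> hom K G"
    using f subgroup.subset[OF H] by (auto simp: iso_def hom_def Pi_def)
  then show thesis
    using that[of f] f assms(2,3) by (auto simp: group_hom_def group_hom_axioms_def iso_def bij_betw_def)
qed

theorem lemma6:
  fixes G :: "('a, 'm) monoid_scheme" and p k :: nat
  assumes "Factorial_Ring.prime p" and "odd p" and "k \<ge> 3"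
    and "group G" and "Coset.order G = p ^ (2 * k - 1)"
  shows "\<not> all_groups_embed (p ^ k) G"
proof
  assume all: "all_groups_embed (p ^ k) G"
  interpret G: group G by fact
  have p1: "p > 1"
    using assms(1) by (rule prime_gt_1_nat)
  have p0: "p > 0" and pk0: "p ^ k > 0"
    using p1 by auto
  note embed = all_groups_embed_any_type[OF all pk0]

  let ?V = "elementary_abelian_group p k"
  note V = elementary_abelian_group[OF p0, where n = k]
  obtain f where f: "group_hom ?V G f" "inj_on f (carrier ?V)"
    using embeds_inE[OF embed[OF V(1,2)] V(1) assms(4)] by blast
  interpret f: group_hom ?V G f by (fact f(1))
  define E where "E = f ` carrier ?V"
  have E: "subgroup E G"
    unfolding E_def by (rule f.img_is_subgroup)
  have cardE: "card E = p ^ k"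
    using card_image[OF f(2)] V(2) by (simp add: E_def order_def)
  have Ecomm: "x \<otimes>\<^bsub>G\<^esub> y = y \<otimes>\<^bsub>G\<^esub> x" if xy: "x \<in> E" "y \<in> E" for x y
  proof -
    obtain a b where "a \<in> carrier ?V" "b \<in> carrier ?V" "x = f a" "y = f b"
      using xy unfolding E_def by blast
    then show ?thesis
      using V(4)[of a b] by (metis f.hom_mult)
  qed
  have Eexp: "x [^]\<^bsub>G\<^esub> p = \<one>\<^bsub>G\<^esub>" if "x \<in> E" for x
    using that V(3) by (auto simp: E_def simp flip: f.hom_nat_pow)

  let ?C = "integer_mod_group (p ^ k)"
  have C_order: "Coset.order ?C = p ^ k"
    using p0 by (simp add: order_def carrier_integer_mod_group nat_power_eq)
  obtain h where h: "group_hom ?C G h" "inj_on h (carrier ?C)"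
    using embeds_inE[OF embed[OF group_integer_mod_group C_order] group_integer_mod_group assms(4)]
    by blast
  interpret h: group_hom ?C G h by (fact h(1))
  have one: "1 \<in> carrier ?C"
    using p1 assms(3) by simp
  have "(h 1) [^]\<^bsub>G\<^esub> n = \<one>\<^bsub>G\<^esub> \<longleftrightarrow> p ^ k dvd n" for n
  proof -
    have "(h 1) [^]\<^bsub>G\<^esub> n = \<one>\<^bsub>G\<^esub> \<longleftrightarrow> h (1 [^]\<^bsub>?C\<^esub> n) = h \<one>\<^bsub>?C\<^esub>"
      using one by (simp only: h.hom_nat_pow h.hom_one)
    also have "\<dots> \<longleftrightarrow> 1 [^]\<^bsub>?C\<^esub> n = \<one>\<^bsub>?C\<^esub>"
      using h(2) one h.G.nat_pow_closed[OF one] h.G.one_closed by (simp only: inj_on_eq_iff)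
    also have "\<dots> \<longleftrightarrow> p ^ k dvd n"
      by (simp add: mod_eq_0_iff_dvd flip: of_nat_power)
    finally show ?thesis .
  qed
  then have ord: "G.ord (h 1) = p ^ k"
    using one by (simp add: G.ord_unique)

  obtain K :: "((int \<times> int \<times> int) \<times> (nat \<Rightarrow> int)) monoid"
    where K: "group K" "Coset.order K = p ^ k"
      and Kexp: "\<And>x. x \<in> carrier K \<Longrightarrow> x [^]\<^bsub>K\<^esub> p = \<one>\<^bsub>K\<^esub>"
      and Kcomm: "\<exists>x\<in>carrier K. \<exists>y\<in>carrier K. x \<otimes>\<^bsub>K\<^esub> y \<noteq> y \<otimes>\<^bsub>K\<^esub> x"
    using nonabelian_group_of_odd_prime_exponent[OF p1 assms(2,3)] by blast
  obtain q where q: "group_hom K G q" "inj_on q (carrier K)"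
    using embeds_inE[OF embed[OF K] K(1) assms(4)] by blast
  interpret q: group_hom K G q by (fact q(1))
  obtain x y where xy: "x \<in> carrier K" "y \<in> carrier K" "x \<otimes>\<^bsub>K\<^esub> y \<noteq> y \<otimes>\<^bsub>K\<^esub> x"
    using Kcomm by blast
  have qexp: "q a [^]\<^bsub>G\<^esub> p = \<one>\<^bsub>G\<^esub>" if "a \<in> carrier K" for a
    using that Kexp by (simp flip: q.hom_nat_pow)
  have "q x \<otimes>\<^bsub>G\<^esub> q y = q y \<otimes>\<^bsub>G\<^esub> q x"
    using xy(1,2) qexp one
    by (intro G.elements_of_order_p_commute[OF assms(1-3,5) _ ord E cardE Ecomm Eexp]) auto
  then have "q (x \<otimes>\<^bsub>K\<^esub> y) = q (y \<otimes>\<^bsub>K\<^esub> x)"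
    using xy(1,2) by simp
  then have "x \<otimes>\<^bsub>K\<^esub> y = y \<otimes>\<^bsub>K\<^esub> x"
    by (rule inj_onD[OF q(2)]) (use xy in auto)
  then show False
    using xy(3) by contradiction
qed

end
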